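(* Let $\gamma\in(-3,0)$ and let $q$ satisfy $\frac{\gamma+6}{2}<q<3$. Define the positive function $$f(v)=\begin{cases}|v|^{-q}, & |v|\le1,\\ e^{-|v|+1}, & |v|>1,\end{cases}\qquad v\in\mathbb{R}^3 .$$ Then $$\int_{\mathbb{R}^3}f(v)\,(1+|v|^2+|\log f|)\,dv<\infty,$$ but $$\iint_{\mathbb{R}^3\times\mathbb{R}^3}f(v)f(v_* )\,|v-v_*|^\gamma\,dv\,dv_*=+\infty .$$
   Context: No special notation; $v,v_*\in\mathbb{R}^3$ and all integrals are with respect to Lebesgue measure. *)

theory Defs
  imports "HOL-Analysis.Analysis"
begin

(* The formula |v|^(-q) is singular at the origin; there powr returns 0. The value at this
   one point is immaterial for integrals with respect to Lebesgue measure. *)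
definition f_q :: "real \<Rightarrow> real ^ 3 \<Rightarrow> real" where
  "f_q q v = (if norm v \<le> 1 then norm v powr (- q) else exp (- norm v + 1))"

lemma f_q_pos: "v \<noteq> 0 \<Longrightarrow> 0 < f_q q v"
  by (simp add: f_q_def)

end

theory Submission
  imports Defs "HOL-Real_Asymp.Real_Asymp"
begin

text \<open>Integrability: on the shell \<open>exp (- k - 1) < |v| \<le> exp (- k)\<close> the integrand is
  \<open>O(k * exp (q * k))\<close>, against a volume \<open>O(exp (- 3 * k))\<close>, and \<open>q < 3\<close>; the part
  \<open>|v| > 1\<close> is handled by shells of unit thickness.
  Divergence: for \<open>v\<close>, \<open>w\<close> in the ball of radius \<open>r \<le> 1\<close> the integrand is at least
  \<open>r powr (- 2 * q) * (2 * r) powr \<gamma>\<close>, so the double integral is at least a constant times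
  \<open>r powr (6 + \<gamma> - 2 * q)\<close>, which tends to infinity as \<open>r\<close> tends to \<open>0\<close>.\<close>

lemma f_q_nonneg: "0 \<le> f_q q v"
  by (simp add: f_q_def)

lemma borel_measurable_f_q [measurable]: "f_q q \<in> borel_measurable borel"
  unfolding f_q_def[abs_def] by measurable

lemma emeasure_cball_real3:
  assumes "r \<ge> 0"
  shows "emeasure lborel (cball (c :: real ^ 3) r) = ennreal (unit_ball_vol 3 * r ^ 3)"
  using emeasure_cball[OF assms, of c] by simp

lemma AE_lborel_neq: "AE x in lborel. x \<noteq> (a :: 'a :: euclidean_space)"
  by (rule AE_I[where N = "{a}"]) auto

text \<open>Away from the null set {0}, a single term of the series of \<open>M k\<close> times the
  indicator of \<open>cball 0 (R k)\<close> already dominates the integrand, so the integral is at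
  most the sum of the terms \<open>M k\<close> times the volume of a ball. Enclosing balls replace
  shells because their volume is explicit and, for the radii used below, still small enough.\<close>

lemma nn_integral_finite_by_balls:
  fixes g :: "real ^ 3 \<Rightarrow> real" and R M :: "nat \<Rightarrow> real"
  assumes bound: "\<And>v. v \<in> A \<Longrightarrow> v \<noteq> 0 \<Longrightarrow> \<exists>k. norm v \<le> R k \<and> g v \<le> M k"
    and M: "\<And>k. 0 \<le> M k" and R: "\<And>k. 0 \<le> R k"
    and summable: "summable (\<lambda>k. M k * R k ^ 3)"
  shows "(\<integral>\<^sup>+ v. ennreal (g v) * indicator A v \<partial>lborel) < \<infinity>"
proof -
  have term_le_suminf: "h k \<le> suminf h" for h :: "nat \<Rightarrow> ennreal" and k
    using sum_le_suminf[of h "{k}"] by simp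
  have "ennreal (g v) * indicator A v \<le> (\<Sum>k. ennreal (M k) * indicator (cball 0 (R k)) v)"
    if "v \<noteq> 0" for v
  proof (cases "v \<in> A")
    case True
    then obtain k where k: "norm v \<le> R k" "g v \<le> M k"
      using bound \<open>v \<noteq> 0\<close> by blast
    have "ennreal (g v) * indicator A v \<le> ennreal (M k) * indicator (cball 0 (R k)) v"
      using True k by (simp add: ennreal_leI)
    also have "\<dots> \<le> (\<Sum>k. ennreal (M k) * indicator (cball 0 (R k)) v)"
      using term_le_suminf[of "\<lambda>k. ennreal (M k) * indicator (cball 0 (R k)) v"] .
    finally show ?thesis .
  qed simp
  then have "(\<integral>\<^sup>+ v. ennreal (g v) * indicator A v \<partial>lborel)
      \<le> (\<integral>\<^sup>+ v. (\<Sum>k. ennreal (M k) * indicator (cball (0 :: real ^ 3) (R k)) v) \<partial>lborel)"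
    using AE_lborel_neq[of "0 :: real ^ 3"] by (intro nn_integral_mono_AE) auto
  also have "\<dots> = (\<Sum>k. ennreal (M k) * emeasure lborel (cball (0 :: real ^ 3) (R k)))"
    by (subst nn_integral_suminf)
      (auto simp: nn_integral_cmult_indicator intro!: borel_measurable_times_ennreal borel_measurable_indicator)
  also have "\<dots> = (\<Sum>k. ennreal (unit_ball_vol 3 * (M k * R k ^ 3)))"
    using M R by (simp add: emeasure_cball_real3 mult.left_commute flip: ennreal_mult)
  also have "\<dots> < \<infinity>"
    using M R summable_mult[OF summable]
    by (subst suminf_ennreal2) auto
  finally show ?thesis .
qed

lemma nn_integral_inner_finite:
  assumes "0 \<le> q" "q < 3"
  shows "(\<integral>\<^sup>+ v. ennreal (f_q q v * (1 + (norm v)\<^sup>2 + \<bar>ln (f_q q v)\<bar>))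
    * indicator (cball 0 1) v \<partial>lborel) < \<infinity>"
\<comment> \<open>Here k is the integer part of \<open>- ln (norm v)\<close>, so
  \<open>norm v\<close> lies between \<open>exp (- k - 1)\<close> and \<open>exp (- k)\<close>. In
  \<open>M\<close>, the 2 bounds \<open>1 + (norm v)\<^sup>2\<close> and the 3 bounds the factor q
  in \<open>ln (f_q q v) = - q * ln (norm v)\<close>.\<close>
proof (rule nn_integral_finite_by_balls[where R = "\<lambda>k. exp (- real k)"
      and M = "\<lambda>k. exp (q * (real k + 1)) * (2 + 3 * (real k + 1))"])
  fix v :: "real ^ 3"
  assume v: "v \<in> cball 0 1" "v \<noteq> 0"
  define k where "k = nat \<lfloor>- ln (norm v)\<rfloor>"
  have "ln (norm v) \<le> 0"
    using v by simp
  then have k: "real k \<le> - ln (norm v)" "- ln (norm v) \<le> real k + 1"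
    unfolding k_def by linarith+
  have "norm v = exp (ln (norm v))"
    using v by simp
  also have "\<dots> \<le> exp (- real k)"
    using k by simp
  finally have R: "norm v \<le> exp (- real k)" .
  have f: "f_q q v = exp (q * - ln (norm v))"
    using v by (simp add: f_q_def powr_def)
  have "f_q q v \<le> exp (q * (real k + 1))"
    unfolding f exp_le_cancel_iff using k(2) assms by (intro mult_left_mono)
  moreover have "\<bar>ln (f_q q v)\<bar> \<le> 3 * (real k + 1)"
  proof -
    have "\<bar>ln (f_q q v)\<bar> = q * - ln (norm v)"
      using \<open>ln (norm v) \<le> 0\<close> assms unfolding f by (simp add: abs_mult)
    also have "\<dots> \<le> 3 * (real k + 1)"
      using k assms \<open>ln (norm v) \<le> 0\<close> by (intro mult_mono) auto
    finally show ?thesis .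
  qed
  moreover have "(norm v)\<^sup>2 \<le> 1"
    using v by (simp add: power_le_one)
  ultimately have "f_q q v * (1 + (norm v)\<^sup>2 + \<bar>ln (f_q q v)\<bar>)
      \<le> exp (q * (real k + 1)) * (2 + 3 * (real k + 1))"
    by (intro mult_mono) (auto intro: f_q_nonneg)
  with R show "\<exists>k. norm v \<le> exp (- real k) \<and>
      f_q q v * (1 + (norm v)\<^sup>2 + \<bar>ln (f_q q v)\<bar>)
      \<le> exp (q * (real k + 1)) * (2 + 3 * (real k + 1))"
    by blast
next
  show "summable (\<lambda>k. exp (q * (real k + 1)) * (2 + 3 * (real k + 1)) * exp (- real k) ^ 3)"
  proof (rule summable_comparison_test_bigo)
    show "summable (\<lambda>k. norm (inverse (real k ^ 2)))"
      using inverse_power_summable[of 2, where 'a = real] by simp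
    \<comment> \<open>The sign of the exponent decides the asymptotics: the decay of
      \<open>exp ((q - 3) * k)\<close> beats the linear factor.\<close>
    have "q - 3 < 0"
      using assms by simp
    then have "(\<lambda>k. exp q * exp ((q - 3) * real k) * (2 + 3 * (real k + 1)))
        \<in> O(\<lambda>k. inverse (real k ^ 2))"
      by real_asymp
    \<comment> \<open>The cubed radius is merged with the growth of f, exposing the exponent q -
      3.\<close>
    moreover have "exp (q * (real k + 1)) * P * exp (- real k) ^ 3
        = exp q * exp ((q - 3) * real k) * P" for k P
    proof -
      have "exp (- real k) ^ 3 = exp (3 * - real k)"
        using exp_of_nat_mult[of 3 "- real k"] by simp
      moreover have "exp (q * (real k + 1)) * exp (3 * - real k) = exp q * exp ((q - 3) * real k)"
        unfolding exp_add[symmetric] by (simp add: algebra_simps)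
      ultimately show ?thesis
        by (metis mult.commute mult.left_commute)
    qed
    ultimately show "(\<lambda>k. exp (q * (real k + 1)) * (2 + 3 * (real k + 1)) * exp (- real k) ^ 3)
        \<in> O(\<lambda>k. inverse (real k ^ 2))"
      by (simp only:)
  qed
qed auto

lemma nn_integral_outer_finite:
  "(\<integral>\<^sup>+ v. ennreal (f_q q v * (1 + (norm v)\<^sup>2 + \<bar>ln (f_q q v)\<bar>))
    * indicator (- cball 0 1) v \<partial>lborel) < \<infinity>"
\<comment> \<open>Now k is the integer part of \<open>norm v\<close>. Outside the unit ball
  \<open>\<bar>ln (f_q q v)\<bar> = norm v - 1\<close>, which is at most k, and the exponential
  beats the polynomial weight and volume.\<close>
proof (rule nn_integral_finite_by_balls[where R = "\<lambda>k. real k + 1"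
      and M = "\<lambda>k. exp (1 - real k) * (2 + (real k + 1)\<^sup>2 + real k)"])
  fix v :: "real ^ 3"
  assume v: "v \<in> - cball 0 1"
  define k where "k = nat \<lfloor>norm v\<rfloor>"
  have k: "real k \<le> norm v" "norm v \<le> real k + 1"
    using norm_ge_zero[of v] unfolding k_def by linarith+
  have f: "f_q q v = exp (1 - norm v)"
    using v by (simp add: f_q_def)
  have "f_q q v * (1 + (norm v)\<^sup>2 + \<bar>ln (f_q q v)\<bar>)
      \<le> exp (1 - real k) * (2 + (real k + 1)\<^sup>2 + real k)"
  proof (rule mult_mono)
    have "(norm v)\<^sup>2 \<le> (real k + 1)\<^sup>2"
      using k by (intro power_mono) auto
    moreover have "\<bar>ln (f_q q v)\<bar> = norm v - 1"
      using v by (simp add: f)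
    ultimately show "1 + (norm v)\<^sup>2 + \<bar>ln (f_q q v)\<bar> \<le> 2 + (real k + 1)\<^sup>2 + real k"
      using k by linarith
  qed (use k in \<open>auto simp: f\<close>)
  with k(2) show "\<exists>k. norm v \<le> real k + 1 \<and>
      f_q q v * (1 + (norm v)\<^sup>2 + \<bar>ln (f_q q v)\<bar>)
      \<le> exp (1 - real k) * (2 + (real k + 1)\<^sup>2 + real k)"
    by blast
next
  show "summable (\<lambda>k. exp (1 - real k) * (2 + (real k + 1)\<^sup>2 + real k) * (real k + 1) ^ 3)"
  proof (rule summable_comparison_test_bigo)
    show "summable (\<lambda>k. norm (inverse (real k ^ 2)))"
      using inverse_power_summable[of 2, where 'a = real] by simp
    show "(\<lambda>k. exp (1 - real k) * (2 + (real k + 1)\<^sup>2 + real k) * (real k + 1) ^ 3)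
        \<in> O(\<lambda>k. inverse (real k ^ 2))"
      by real_asymp
  qed
qed (intro mult_nonneg_nonneg add_nonneg_nonneg; simp)+

lemma nn_integral_interaction_ge:
  fixes \<gamma> q r :: real
  assumes "\<gamma> \<le> 0" "0 \<le> q" "0 < r" "r \<le> 1"
  shows "ennreal ((unit_ball_vol 3)\<^sup>2 * 2 powr \<gamma> * r powr (6 + \<gamma> - 2 * q))
    \<le> (\<integral>\<^sup>+ (v, w). ennreal (f_q q v * f_q q w * norm (v - w) powr \<gamma>) \<partial>(lborel \<Otimes>\<^sub>M lborel))"
proof -
  let ?B = "cball (0 :: real ^ 3) r"
  \<comment> \<open>The least size of the integrand on \<open>?B\<close> times \<open>?B\<close>:
    the exponents -q and \<gamma> are nonpositive, \<open>norm v\<close> and \<open>norm w\<close>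
    are at most r, and \<open>norm (v - w)\<close> is at most 2 * r.\<close>
  define c where "c = r powr (- q) * r powr (- q) * (2 * r) powr \<gamma>"
  define V where "V = unit_ball_vol 3 * r ^ 3"
  have "0 \<le> c" "0 \<le> V"
    using assms by (auto simp: c_def V_def)
  \<comment> \<open>The points v = 0, w = 0 and w = v are excluded because
    \<open>0 powr a = 0\<close> makes the integrand vanish there, while c is positive. For fixed v,
    the excluded w form a null set.\<close>
  have bound: "c \<le> f_q q v * f_q q w * norm (v - w) powr \<gamma>"
    if "v \<in> ?B" "w \<in> ?B" "v \<noteq> 0" "w \<noteq> 0" "w \<noteq> v" for v w :: "real ^ 3"
  proof -
    have f: "r powr (- q) \<le> f_q q u" if "u \<in> ?B" "u \<noteq> 0" for u :: "real ^ 3"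
      using that assms by (auto simp: f_q_def intro!: powr_mono2')
    have "norm (v - w) \<le> 2 * r"
      using that norm_triangle_ineq4[of v w] by simp
    then have "(2 * r) powr \<gamma> \<le> norm (v - w) powr \<gamma>"
      using that assms by (intro powr_mono2') auto
    then show ?thesis
      unfolding c_def using f that by (intro mult_mono mult_nonneg_nonneg f_q_nonneg) auto
  qed
  have [measurable]: "(\<lambda>(v, w). ennreal (f_q q v * f_q q w * norm (v - w) powr \<gamma>))
      \<in> borel_measurable (lborel \<Otimes>\<^sub>M lborel)"
    by measurable
  have inner: "ennreal (c * V)
      \<le> (\<integral>\<^sup>+ w. ennreal (f_q q v * f_q q w * norm (v - w) powr \<gamma>) \<partial>lborel)"
    if "v \<in> ?B" "v \<noteq> 0" for v
  proof -
    have "ennreal (c * V) = (\<integral>\<^sup>+ w. ennreal c * indicator ?B w \<partial>lborel)"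
      using assms \<open>0 \<le> c\<close> \<open>0 \<le> V\<close>
      by (simp add: nn_integral_cmult_indicator emeasure_cball_real3 ennreal_mult V_def)
    also have "\<dots> \<le> (\<integral>\<^sup>+ w. ennreal (f_q q v * f_q q w * norm (v - w) powr \<gamma>) \<partial>lborel)"
      using AE_lborel_neq[of "0 :: real ^ 3"] AE_lborel_neq[of v]
      by (intro nn_integral_mono_AE, eventually_elim)
        (use bound that in \<open>auto simp: indicator_def intro!: ennreal_leI\<close>)
    finally show ?thesis .
  qed
  \<comment> \<open>The 6 comes from the volumes of two three-dimensional balls, the rest from
    c.\<close>
  have "r powr (6 + \<gamma> - 2 * q) = (r ^ 3)\<^sup>2 * (r powr \<gamma> * (r powr (- q) * r powr (- q)))"
    using assms by (simp add: powr_add[symmetric] powr_numeral[symmetric] powr_powr algebra_simps del: powr_numeral)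
  then have "ennreal ((unit_ball_vol 3)\<^sup>2 * 2 powr \<gamma> * r powr (6 + \<gamma> - 2 * q)) = ennreal (c * V * V)"
    using assms by (simp add: c_def V_def powr_mult power2_eq_square mult_ac)
  also have "\<dots> = (\<integral>\<^sup>+ v. ennreal (c * V) * indicator ?B v \<partial>lborel)"
    using assms \<open>0 \<le> c\<close> \<open>0 \<le> V\<close>
    by (simp add: nn_integral_cmult_indicator emeasure_cball_real3 ennreal_mult V_def)
  also have "\<dots> \<le> (\<integral>\<^sup>+ v. \<integral>\<^sup>+ w. ennreal (f_q q v * f_q q w * norm (v - w) powr \<gamma>) \<partial>lborel \<partial>lborel)"
    using AE_lborel_neq[of "0 :: real ^ 3"]
    by (intro nn_integral_mono_AE, eventually_elim) (use inner in \<open>auto simp: indicator_def\<close>)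
  also have "\<dots> = (\<integral>\<^sup>+ (v, w). ennreal (f_q q v * f_q q w * norm (v - w) powr \<gamma>)
      \<partial>(lborel \<Otimes>\<^sub>M lborel))"
    by (subst lborel.nn_integral_fst[symmetric]) auto
  finally show ?thesis .
qed

theorem mainTheorem2:
  fixes \<gamma> q :: real
  assumes "-3 < \<gamma>" and "\<gamma> < 0"
    and "(\<gamma> + 6) / 2 < q" and "q < 3"
  shows "(\<integral>\<^sup>+ v. ennreal (f_q q v * (1 + (norm v)\<^sup>2 + \<bar>ln (f_q q v)\<bar>)) \<partial>lborel) < \<infinity>
    \<and> (\<integral>\<^sup>+ (v, w). ennreal (f_q q v * f_q q w * norm (v - w) powr \<gamma>) \<partial>(lborel \<Otimes>\<^sub>M lborel)) = \<infinity>"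
proof
  \<comment> \<open>In fact q > 3/2, since \<gamma> > -3.\<close>
  have "0 \<le> q"
    using assms by simp
  let ?g = "\<lambda>v. ennreal (f_q q v * (1 + (norm v)\<^sup>2 + \<bar>ln (f_q q v)\<bar>))"
  have "(\<integral>\<^sup>+ v. ?g v \<partial>lborel)
      = (\<integral>\<^sup>+ v. ?g v * indicator (cball 0 1) v + ?g v * indicator (- cball 0 1) v \<partial>lborel)"
    by (intro nn_integral_cong) (auto simp: indicator_def)
  also have "\<dots> = (\<integral>\<^sup>+ v. ?g v * indicator (cball 0 1) v \<partial>lborel)
      + (\<integral>\<^sup>+ v. ?g v * indicator (- cball 0 1) v \<partial>lborel)"
    by (rule nn_integral_add)
      (auto intro!: borel_measurable_times_ennreal borel_measurable_indicator)
  also have "\<dots> < \<infinity>"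
    using nn_integral_inner_finite[OF \<open>0 \<le> q\<close> assms(4)] nn_integral_outer_finite[of q] by simp
  finally show "(\<integral>\<^sup>+ v. ?g v \<partial>lborel) < \<infinity>" .

  let ?I = "\<integral>\<^sup>+ (v, w). ennreal (f_q q v * f_q q w * norm (v - w) powr \<gamma>) \<partial>(lborel \<Otimes>\<^sub>M lborel)"
  define C where "C = (unit_ball_vol 3)\<^sup>2 * 2 powr \<gamma>"
  show "?I = \<infinity>"
  proof (rule ccontr)
    assume "?I \<noteq> \<infinity>"
    then obtain K where K: "?I = ennreal K" "0 \<le> K"
      by (cases ?I) auto
    have "0 < C"
      unfolding C_def by (intro mult_pos_pos zero_less_power unit_ball_vol_pos) auto
    \<comment> \<open>This is the lower bound on q rearranged; it makes the power of r blow up at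
      0.\<close>
    moreover have "6 + \<gamma> - 2 * q < 0"
      using assms by simp
    ultimately have "filterlim (\<lambda>r. C * r powr (6 + \<gamma> - 2 * q)) at_top (at_right 0)"
      by real_asymp
    then have "\<forall>\<^sub>F r in at_right 0. K < C * r powr (6 + \<gamma> - 2 * q)"
      by (simp add: filterlim_at_top_dense)
    moreover have "\<forall>\<^sub>F r in at_right (0 :: real). 0 < r \<and> r \<le> 1"
      by (auto simp: eventually_at_right_field intro!: exI[of _ 1])
    \<comment> \<open>The filter at 0 from the right is nontrivial, so \<open>False\<close> cannot
      hold eventually.\<close>
    ultimately have "\<forall>\<^sub>F r in at_right (0 :: real). False"
    proof eventually_elim
      case (elim r)
      then have "ennreal (C * r powr (6 + \<gamma> - 2 * q)) \<le> ennreal K"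
        using nn_integral_interaction_ge[of \<gamma> q r] assms \<open>0 \<le> q\<close> K by (simp add: C_def)
      with elim K show False
        by (simp add: ennreal_le_iff)
    qed
    then show False
      by simp
  qed
qed

end
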